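(* Let $M$ be a (nonempty) compact metric space, $X=(X,\lVert\cdot\rVert)$ a separable Banach space, $\Phi=(\phi_t)_{t\ge0}$ a semi-flow on $M$, and $\mathcal{A}\colon M\times[0,\infty)\to B(X)$ a cocycle over $\Phi$. Let $\mu$ be an ergodic $\Phi$-invariant Borel probability measure on $M$. Assume that there exist $p>0$ and a measurable function $C\colon M\to(0,\infty)$ such that \[ \bigg(\int_0^\infty\lVert\mathcal{A}(q,t)x\rVert^p\,dt\bigg)^{1/p}\le C(q)\lVert x\rVert \] for $\mu$-a.e. $q\in M$ and every $x\in X$. Then the largest Lyapunov exponent of $\mathcal{A}$ with respect to $\mu$ satisfies $\lambda_\mu(\mathcal{A})<0$.
   Context: $B(X)$ is the space of all bounded linear operators on $X$. A family of maps $\Phi=(\phi_t)_{t\ge0}$, $\phi_t\colon M\to M$, is a semi-flow if: each $\phi_t$ is continuous; $\phi_0=\mathrm{Id}$; $\phi_{t+s}=\phi_t\circ\phi_s$ for $t,s\ge0$; and $(q,t)\mapsto\phi_t(q)$ is continuous on $M\times[0,\infty)$. A map $\mathcal{A}\colon M\times[0,\infty)\to B(X)$ is a cocycle over $\Phi$ if: (i) $\mathcal{A}(q,0)=\mathrm{Id}$ for $q\in M$; (ii) $\mathcal{A}(q,t+s)=\mathcal{A}(\phi_s(q),t)\mathcal{A}(q,s)$ for $q\in M$ and $t,s\ge0$; (iii) $(q,t)\mapsto\mathcal{A}(q,t)x$ is continuous on $M\times[0,\infty)$ for each $x\in X$. It follows that there are $K,\omega>0$ with $\lVert\mathcal{A}(q,t)\rVert\le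 Ke^{\omega t}$ for all $q\in M$, $t\ge0$. By Kingman's subadditive ergodic theorem, for each ergodic $\Phi$-invariant Borel probability measure $\mu$ there is a number $\lambda_\mu(\mathcal{A})\in[-\infty,\infty)$ with \[ \lambda_\mu(\mathcal{A})=\lim_{t\to\infty}\frac1t\log\lVert\mathcal{A}(q,t)\rVert\quad\text{for }\mu\text{-a.e. }q\in M \] (convention $\log0=-\infty$). It is called the largest Lyapunov exponent of $\mathcal{A}$ with respect to $\mu$. *)

theory Defs
  imports "HOL-Probability.Probability"
begin

definition semi_flow :: "(real \<Rightarrow> 'm::topological_space \<Rightarrow> 'm) \<Rightarrow> bool" where
  "semi_flow \<phi> \<longleftrightarrow>
     (\<forall>t\<ge>0. continuous_on UNIV (\<phi> t)) \<and>
     \<phi> 0 = id \<and>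
     (\<forall>t\<ge>0. \<forall>s\<ge>0. \<phi> (t + s) = \<phi> t \<circ> \<phi> s) \<and>
     continuous_on (UNIV \<times> {0..}) (\<lambda>(q, t). \<phi> t q)"

definition cocycle ::
  "(real \<Rightarrow> 'm::topological_space \<Rightarrow> 'm) \<Rightarrow> ('m \<Rightarrow> real \<Rightarrow> 'x::real_normed_vector \<Rightarrow>\<^sub>L 'x) \<Rightarrow> bool" where
  "cocycle \<phi> A \<longleftrightarrow>
     (\<forall>q. A q 0 = id_blinfun) \<and>
     (\<forall>q. \<forall>t\<ge>0. \<forall>s\<ge>0. A q (t + s) = A (\<phi> s q) t o\<^sub>L A q s) \<and>
     (\<forall>x. continuous_on (UNIV \<times> {0..}) (\<lambda>(q, t). blinfun_apply (A q t) x))"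

definition invariant_measure :: "(real \<Rightarrow> 'm \<Rightarrow> 'm) \<Rightarrow> 'm measure \<Rightarrow> bool" where
  "invariant_measure \<phi> \<mu> \<longleftrightarrow>
     (\<forall>t\<ge>0. \<forall>B\<in>sets \<mu>. emeasure \<mu> (\<phi> t -` B \<inter> space \<mu>) = emeasure \<mu> B)"

definition ergodic_measure :: "(real \<Rightarrow> 'm \<Rightarrow> 'm) \<Rightarrow> 'm measure \<Rightarrow> bool" where
  "ergodic_measure \<phi> \<mu> \<longleftrightarrow>
     invariant_measure \<phi> \<mu> \<and>
     (\<forall>B\<in>sets \<mu>. (\<forall>t\<ge>0. \<phi> t -` B \<inter> space \<mu> = B) \<longrightarrow> emeasure \<mu> B = 0 \<or> emeasure \<mu> B = 1)"

text \<open>The library's real logarithm has \<open>ln 0 = 0\<close>; here \<open>log 0 = -\<infinity>\<close>. Only used for \<open>r \<ge> 0\<close>.\<close>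

definition ext_log :: "real \<Rightarrow> ereal" where
  "ext_log r = (if r = 0 then -\<infinity> else ereal (ln r))"

definition has_lyapunov_exponent ::
  "'m measure \<Rightarrow> ('m \<Rightarrow> real \<Rightarrow> 'x::real_normed_vector \<Rightarrow>\<^sub>L 'x) \<Rightarrow> ereal \<Rightarrow> bool" where
  "has_lyapunov_exponent \<mu> A l \<longleftrightarrow>
     (AE q in \<mu>. ((\<lambda>t. ereal (1 / t) * ext_log (norm (A q t))) \<longlongrightarrow> l) at_top)"

text \<open>The value is meaningful only if the almost sure limit exists and is almost surely constant,
  which Kingman's theorem provides for cocycles over an ergodic measure; existence is not built
  into the definition.\<close>

definition largest_lyapunov_exponent ::
  "'m measure \<Rightarrow> ('m \<Rightarrow> real \<Rightarrow> 'x::real_normed_vector \<Rightarrow>\<^sub>L 'x) \<Rightarrow> ereal" where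
  "largest_lyapunov_exponent \<mu> A = (THE l. has_lyapunov_exponent \<mu> A l)"

lemma has_lyapunov_exponent_unique:
  assumes "prob_space \<mu>" "has_lyapunov_exponent \<mu> A l" "has_lyapunov_exponent \<mu> A l'"
  shows "l = l'"
proof -
  interpret prob_space \<mu> by fact
  have "AE q in \<mu>. l = l'"
    using assms(2,3) unfolding has_lyapunov_exponent_def
    by eventually_elim (rule tendsto_unique[OF trivial_limit_at_top_linorder])
  then show ?thesis by simp
qed

lemma largest_lyapunov_exponent_eq:
  assumes "prob_space \<mu>" "has_lyapunov_exponent \<mu> A l"
  shows "largest_lyapunov_exponent \<mu> A = l"
  unfolding largest_lyapunov_exponent_def
  using assms by (blast intro: the_equality has_lyapunov_exponent_unique)

end

theory Submission
  imports Defs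
begin

text \<open>By submultiplicativity, the sets of points along which the cocycle is bounded by a multiple of
  \<open>exp (r t)\<close> for all times, or for arbitrarily large times, are invariant up to a null set, so by
  ergodicity they have measure 0 or 1. Cutting orbits into blocks shows that growth at rate \<open>r\<close> for
  arbitrarily large times implies growth at rate \<open>r'\<close> for all times and every \<open>r' > r\<close>, once the
  maximal inequality controls how often an orbit visits the points from which no good block of
  bounded length starts. This is Kingman's theorem for the cocycle; the exponent is the infimum of
  the almost sure rates. To see that it is negative, fix a large set \<open>S\<close> on which \<open>C\<close> is bounded:
  Datko's argument makes the cocycle contract exponentially in the number of visits to \<open>S\<close>, and by
  the maximal inequality some set of positive measure consists of points whose orbits always spend
  at least half of their time in \<open>S\<close>.\<close>

section \<open>Boundedness and measurability of cocycles\<close>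

text \<open>By Baire's theorem some closed set \<open>F n\<close> contains a ball. Differences of
  two points of that ball bound every \<open>f i\<close> by \<open>2 * n\<close> on vectors of norm
  \<open>e / 2\<close>, which gives the constant \<open>4 * n / e\<close>.\<close>

lemma uniform_boundedness:
  fixes f :: "'i \<Rightarrow> 'a::banach \<Rightarrow>\<^sub>L 'b::real_normed_vector"
  assumes "\<And>x. \<exists>c. \<forall>i\<in>I. norm (f i x) \<le> c"
  shows "\<exists>K. \<forall>i\<in>I. norm (f i) \<le> K"
proof -
  define F where "F n = {x. \<forall>i\<in>I. norm (f i x) \<le> real n}" for n
  have cl: "closed (F n)" for n
    unfolding F_def Collect_ball_eq
    by (intro closed_INT ballI closed_Collect_le continuous_intros)
  have un: "(\<Union>n. F n) = UNIV"
  proof -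
    have "\<exists>n. x \<in> F n" for x
    proof -
      obtain c where c: "\<forall>i\<in>I. norm (f i x) \<le> c" using assms by blast
      obtain n where "c \<le> real n" using real_arch_simple by blast
      with c show ?thesis unfolding F_def by (auto intro!: exI[of _ n] dest!: bspec)
    qed
    then show ?thesis by blast
  qed
  have "\<exists>n. interior (F n) \<noteq> {}"
  proof (rule ccontr)
    assume "\<nexists>n. interior (F n) \<noteq> {}"
    then have "interior (\<Union>(range F)) = {}"
      using Baire_category_alt[OF disjI1[OF completely_metrizable_space_euclidean], of "range F"] cl
      by auto
    then show False using un by simp
  qed
  then obtain n x e where e: "e > 0" "ball x e \<subseteq> F n"
    by (meson ex_in_conv mem_interior)
  have bound: "norm (f i) \<le> 4 * real n / e" if "i \<in> I" for i
  proof (rule norm_blinfun_bound)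
    fix y
    show "norm (f i y) \<le> 4 * real n / e * norm y"
    proof (cases "y = 0")
      case False
      define z where "z = (e / (2 * norm y)) *\<^sub>R y"
      have nz: "norm z = e / 2" using False e by (simp add: z_def)
      have "x + z \<in> F n" "x \<in> F n"
        using e nz by (auto intro!: subsetD[OF e(2)] simp: dist_norm)
      then have "norm (f i (x + z)) \<le> n" "norm (f i x) \<le> n" using that by (auto simp: F_def)
      moreover have "f i z = f i (x + z) - f i x" by (simp add: blinfun.add_right)
      ultimately have "norm (f i z) \<le> 2 * real n"
        using norm_triangle_ineq4[of "f i (x + z)" "f i x"] by simp
      moreover have "norm (f i z) = e / (2 * norm y) * norm (f i y)"
        using e by (simp add: z_def blinfun.scaleR_right)
      ultimately show ?thesis using e False by (simp add: field_simps)
    qed simp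
  qed (use e in simp)
  then show ?thesis by blast
qed

lemma semi_flow_continuous_on:
  assumes "semi_flow \<phi>" "t \<ge> 0"
  shows "continuous_on UNIV (\<phi> t)"
  using assms by (simp add: semi_flow_def)

lemma cocycle_continuous_on:
  assumes "cocycle \<phi> A" "t \<ge> 0"
  shows "continuous_on UNIV (\<lambda>q. A q t x)"
proof -
  have "continuous_on (UNIV \<times> {0..}) (\<lambda>(q, t). A q t x)"
    using assms by (simp add: cocycle_def)
  then have "continuous_on UNIV (\<lambda>q. (\<lambda>(q, t). A q t x) (q, t))"
    by (rule continuous_on_compose2) (use assms in \<open>auto intro!: continuous_intros\<close>)
  then show ?thesis by simp
qed

text \<open>The cocycle is only strongly continuous. Compactness bounds the images of each vector
  over times in \<open>{0..1}\<close>, and uniform boundedness turns this into a bound on operator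
  norms.\<close>

lemma cocycle_locally_bounded:
  fixes A :: "'m::metric_space \<Rightarrow> real \<Rightarrow> 'x::banach \<Rightarrow>\<^sub>L 'x"
  assumes "compact (UNIV :: 'm set)" "cocycle \<phi> A"
  shows "\<exists>K. \<forall>q. \<forall>t\<in>{0..1}. norm (A q t) \<le> K"
proof -
  have "\<exists>c. \<forall>(q, t)\<in>UNIV \<times> {0..1}. norm (A q t x) \<le> c" for x
  proof -
    have "continuous_on (UNIV \<times> {0..}) (\<lambda>(q, t). A q t x)"
      using assms(2) by (simp add: cocycle_def)
    then have "continuous_on (UNIV \<times> {0..1}) (\<lambda>(q, t). A q t x)"
      by (rule continuous_on_subset) auto
    then have "compact ((\<lambda>(q, t). A q t x) ` (UNIV \<times> {0..1}))"
      by (intro compact_continuous_image compact_Times assms compact_Icc)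
    then have "bounded ((\<lambda>(q, t). A q t x) ` (UNIV \<times> {0..1}))" by (rule compact_imp_bounded)
    then show ?thesis unfolding bounded_iff by fastforce
  qed
  then have "\<exists>K. \<forall>p\<in>UNIV \<times> {0..1}. norm (case p of (q, t) \<Rightarrow> A q t) \<le> K"
    by (intro uniform_boundedness) (simp add: case_prod_unfold)
  then show ?thesis by auto
qed

text \<open>The operator norm is lower semicontinuous in \<open>q\<close>: its sublevel sets are
  intersections of closed sets, one for each vector.\<close>

lemma cocycle_norm_measurable:
  fixes A :: "'m::topological_space \<Rightarrow> real \<Rightarrow> 'x::real_normed_vector \<Rightarrow>\<^sub>L 'x"
  assumes "cocycle \<phi> A" "t \<ge> 0"
  shows "(\<lambda>q. norm (A q t)) \<in> borel_measurable borel"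
  unfolding borel_measurable_iff_le
proof
  fix c
  show "{q \<in> space borel. norm (A q t) \<le> c} \<in> sets borel"
  proof (cases "c \<ge> 0")
    case True
    have "norm (A q t) \<le> c \<longleftrightarrow> (\<forall>x. norm (A q t x) \<le> c * norm x)" for q
      using True norm_blinfun_bound[of c "A q t"]
      by (meson mult_right_mono norm_blinfun norm_ge_zero order_trans)
    then have "{q. norm (A q t) \<le> c} = (\<Inter>x. {q. norm (A q t x) \<le> c * norm x})" by auto
    also have "closed \<dots>"
      by (intro closed_INT ballI closed_Collect_le continuous_intros cocycle_continuous_on[OF assms])
    finally show ?thesis by simp
  next
    case False
    then have "{q. norm (A q t) \<le> c} = {}" by (auto dest: order_trans[OF norm_ge_zero])
    then show ?thesis by simp
  qed
qed

section \<open>The maximal inequality\<close>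

definition visits :: "('a \<Rightarrow> 'a) \<Rightarrow> 'a set \<Rightarrow> nat \<Rightarrow> 'a \<Rightarrow> real" where
  "visits T D n q = (\<Sum>k<n. indicator D ((T ^^ k) q))"

lemma visits_0 [simp]: "visits T D 0 q = 0"
  by (simp add: visits_def)

lemma visits_Suc: "visits T D (Suc n) q = visits T D n q + indicator D ((T ^^ n) q)"
  by (simp add: visits_def)

lemma visits_nonneg: "visits T D n q \<ge> 0"
  by (simp add: visits_def sum_nonneg)

lemma visits_add: "visits T D (m + n) q = visits T D m q + visits T D n ((T ^^ m) q)"
proof (induction n)
  case (Suc n)
  have "(T ^^ n) ((T ^^ m) q) = (T ^^ (m + n)) q"
    by (simp add: funpow_add add.commute[of m])
  with Suc show ?case by (simp add: visits_Suc)
qed simp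

lemma visits_add_Compl: "visits T D n q + visits T (- D) n q = n"
  by (induction n) (auto simp: visits_Suc split: split_indicator)

lemma visits_le: "visits T D n q \<le> n"
  using visits_add_Compl[of T D n q] visits_nonneg[of T "- D" n q] by simp

text \<open>Walk along the orbit: step once from a point outside \<open>E\<close>, and jump over a
  block of length at most \<open>N\<close> from a point of \<open>E\<close>. The visits to
  \<open>D\<close> in a block of length \<open>l\<close> number at least \<open>c * l\<close>, so at
  least \<open>c\<close> times those to \<open>E\<close>. The term \<open>c * N\<close> pays for the
  last stretch, of length at most \<open>N\<close>.\<close>

lemma visits_ge_greedy:
  assumes "c > 0"
    and E: "\<And>q. q \<in> E \<Longrightarrow> \<exists>l\<in>{1..N}. c * real l \<le> visits T D l q"
  shows "c * visits T E n q \<le> visits T D n q + c * N"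
proof (induction n arbitrary: q rule: less_induct)
  case (less n)
  consider "n \<le> N" | "n > N" "q \<notin> E" | "n > N" "q \<in> E" by linarith
  then show ?case
  proof cases
    case 1
    have "visits T E n q \<le> N" using visits_le[of T E n q] 1 by simp
    then have "c * visits T E n q \<le> c * N" using assms(1) by (intro mult_left_mono) auto
    then show ?thesis using visits_nonneg[of T D n q] by linarith
  next
    case 2
    then obtain m where m: "n = 1 + m" by (cases n) auto
    have "c * visits T E m (T q) \<le> visits T D m (T q) + c * N" using less m by simp
    moreover have "visits T E 1 q = 0" using 2 by (simp add: visits_def)
    ultimately show ?thesis using visits_nonneg[of T D 1 q] unfolding m visits_add
      by (simp add: algebra_simps)
  next
    case 3
    then obtain l where l: "l \<in> {1..N}" "c * l \<le> visits T D l q" using E[of q] by auto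
    then obtain m where m: "n = l + m" using 3 le_Suc_ex[of l n] by auto
    have "c * visits T E m ((T ^^ l) q) \<le> visits T D m ((T ^^ l) q) + c * N"
      using less m l by simp
    moreover have "c * visits T E l q \<le> c * l"
      using visits_le[of T E l q] assms(1) by simp
    ultimately show ?thesis using l(2) unfolding m visits_add by (simp add: distrib_left)
  qed
qed

text \<open>Cut the orbit into blocks: from a point outside \<open>D\<close> take a block on which the growth rate is
  at most \<open>r\<close>, from a point of \<open>D\<close> a single step, which costs an extra factor of at most \<open>exp \<kappa>\<close>.\<close>

lemma submultiplicative_greedy_bound:
  fixes a :: "'a \<Rightarrow> nat \<Rightarrow> real"
  assumes nonneg: "\<And>q n. a q n \<ge> 0"
    and submult: "\<And>q m n. a q (m + n) \<le> a ((T ^^ m) q) n * a q m"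
    and a0: "\<And>q. a q 0 \<le> 1" and a1: "\<And>q. a q 1 \<le> exp k"
    and \<kappa>: "\<kappa> \<ge> \<bar>k\<bar> + \<bar>r\<bar>"
    and D: "\<And>q. q \<notin> D \<Longrightarrow> \<exists>l\<in>{1..N}. a q l \<le> exp (r * real l)"
  shows "a q n \<le> exp (r * real n + \<kappa> * (visits T D n q + real N))"
proof (induction n arbitrary: q rule: less_induct)
  case (less n)
  have step: "a q (m + l) \<le> exp (s + t)" if "a q m \<le> exp s" "a ((T ^^ m) q) l \<le> exp t" for q m l s t
  proof -
    have "a q (m + l) \<le> a ((T ^^ m) q) l * a q m" by (rule submult)
    also have "\<dots> \<le> exp t * exp s" using that nonneg by (intro mult_mono) auto
    finally show ?thesis by (simp add: exp_add mult.commute)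
  qed
  have \<kappa>0: "\<kappa> \<ge> 0" "k \<le> r + \<kappa>" using \<kappa> by linarith+
  consider "n \<le> N" | "n > N" "q \<in> D" | "n > N" "q \<notin> D" by linarith
  then show ?case
  proof cases
    case 1
    have "a q n \<le> exp (k * real n)"
    proof (induction n arbitrary: q)
      case (Suc n)
      then show ?case
        using step[of q 1 "k" n "k * real n"] a1[of q] by (simp add: algebra_simps)
    qed (simp add: a0)
    \<comment> \<open>\<open>\<kappa>\<close> dominates \<open>k - r\<close>, so each of the at most
      \<open>N\<close> remaining steps costs at most an extra \<open>\<kappa>\<close>.\<close>
    also have "k * real n \<le> r * n + \<kappa> * n"
      using \<kappa>0(2) mult_right_mono[of k "r + \<kappa>" "real n"] by (simp add: algebra_simps)
    also have "\<dots> \<le> r * n + \<kappa> * (visits T D n q + N)"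
      using 1 \<kappa>0 visits_nonneg[of T D n q] by (simp add: mult_left_mono)
    finally show ?thesis by simp
  next
    case 2
    then obtain m where m: "n = 1 + m" by (cases n) auto
    have "a q n \<le> exp (k + (r * m + \<kappa> * (visits T D m (T q) + N)))"
      unfolding m using less[of m "T q"] a1[of q] m by (intro step) auto
    \<comment> \<open>The visit at time 0 is not counted from \<open>T q\<close> on; its share
      \<open>\<kappa>\<close> covers the excess of the crude step over rate
      \<open>r\<close>.\<close>
    also have "visits T D m (T q) = visits T D n q - 1"
      unfolding m visits_add using 2 by (simp add: visits_def)
    also have "k + (r * m + \<kappa> * (visits T D n q - 1 + N)) \<le> r * n + \<kappa> * (visits T D n q + N)"
      using \<kappa>0 m by (simp add: algebra_simps)
    finally show ?thesis by simp
  next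
    case 3
    then obtain l where l: "l \<in> {1..N}" "a q l \<le> exp (r * l)" using D[of q] by auto
    then obtain m where m: "n = l + m" using 3 le_Suc_ex[of l n] by auto
    have "a q n \<le> exp (r * l + (r * m + \<kappa> * (visits T D m ((T ^^ l) q) + N)))"
      unfolding m using less[of m "(T ^^ l) q"] l m by (intro step) auto
    moreover have "\<kappa> * (visits T D m ((T ^^ l) q) + N) \<le> \<kappa> * (visits T D n q + N)"
      unfolding m visits_add using visits_nonneg[of T D l q] \<kappa>0 by (intro mult_left_mono) auto
    moreover have "r * n = r * l + r * m" by (simp add: m distrib_left)
    ultimately show ?thesis by (smt (verit) exp_le_cancel_iff)
  qed
qed

section \<open>Maps preserving a probability measure\<close>

locale measure_preserving = prob_space +
  fixes T :: "'a \<Rightarrow> 'a"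
  assumes T_measurable [measurable]: "T \<in> M \<rightarrow>\<^sub>M M"
    and distr_T: "distr M M T = M"
begin

lemma funpow_measurable [measurable]: "T ^^ n \<in> M \<rightarrow>\<^sub>M M"
  by (induction n) (auto simp: id_def)

lemma distr_funpow: "distr M M (T ^^ n) = M"
proof (induction n)
  case 0
  show ?case using distr_id[of M] by (simp add: id_def)
next
  case (Suc n)
  have "distr M M (T ^^ Suc n) = distr (distr M M (T ^^ n)) M T"
    by (subst distr_distr) auto
  then show ?case unfolding Suc distr_T .
qed

lemma prob_funpow_vimage:
  assumes "D \<in> events"
  shows "prob ((T ^^ n) -` D \<inter> space M) = prob D"
  using measure_distr[OF funpow_measurable assms, of n] by (simp add: distr_funpow)

lemma visits_measurable [measurable]:
  assumes [measurable]: "D \<in> events"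
  shows "visits T D n \<in> borel_measurable M"
  unfolding visits_def by measurable

lemma
  assumes [measurable]: "D \<in> events"
  shows integrable_visits: "integrable M (visits T D n)"
    and expectation_visits: "expectation (visits T D n) = n * prob D"
proof -
  have 1: "integrable M (\<lambda>q. indicator D ((T ^^ k) q) :: real)" for k
    by (rule integrable_const_bound[of _ 1]) auto
  have 2: "expectation (\<lambda>q. indicator D ((T ^^ k) q)) = prob D" for k
  proof -
    have "expectation (\<lambda>q. indicator D ((T ^^ k) q) :: real)
        = expectation (indicator ((T ^^ k) -` D \<inter> space M))"
      by (intro Bochner_Integration.integral_cong) (auto split: split_indicator)
    then show ?thesis by (simp add: prob_funpow_vimage)
  qed
  show "integrable M (visits T D n)"
    unfolding visits_def by (intro Bochner_Integration.integrable_sum 1)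
  show "expectation (visits T D n) = n * prob D"
    unfolding visits_def by (subst Bochner_Integration.integral_sum) (auto simp: 1 2)
qed

text \<open>Restrict first to times up to \<open>N\<close> and integrate the greedy inequality over
  the invariant measure. After division by \<open>n\<close> the boundary term
  \<open>c * N / n\<close> vanishes as \<open>n\<close> grows; then \<open>N\<close> tends to
  infinity.\<close>

lemma maximal_inequality:
  assumes [measurable]: "D \<in> events" and "c > 0"
  shows "c * prob {q \<in> space M. \<exists>n\<ge>1. visits T D n q \<ge> c * real n} \<le> prob D"
proof -
  define E where "E N = {q \<in> space M. \<exists>n\<in>{1..N}. visits T D n q \<ge> c * real n}" for N :: nat
  have [measurable]: "E N \<in> events" for N unfolding E_def by measurable
  have E: "c * prob (E N) \<le> prob D" for N
  proof -
    have "c * prob (E N) \<le> prob D + c * N / n" if "n \<ge> 1" for n :: nat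
    proof -
      have "expectation (\<lambda>q. c * visits T (E N) n q) \<le> expectation (\<lambda>q. visits T D n q + c * N)"
        by (intro integral_mono visits_ge_greedy)
          (auto simp: integrable_visits \<open>c > 0\<close>, auto simp: E_def)
      then have "c * (n * prob (E N)) \<le> n * prob D + c * N"
        by (simp add: integrable_visits expectation_visits prob_space)
      then show ?thesis using that by (simp add: field_simps)
    qed
    moreover have "(\<lambda>n. prob D + c * N / real n) \<longlonglongrightarrow> prob D + 0"
      by (intro tendsto_add tendsto_const lim_const_over_n)
    ultimately show ?thesis
      by (intro Lim_bounded2[of _ "prob D" 1]) auto
  qed
  have "incseq E" unfolding incseq_def E_def by force
  then have "(\<lambda>N. prob (E N)) \<longlonglongrightarrow> prob (\<Union>N. E N)"
    by (intro finite_Lim_measure_incseq) auto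
  then have "(\<lambda>N. c * prob (E N)) \<longlonglongrightarrow> c * prob (\<Union>N. E N)" by (rule tendsto_mult_left)
  then have "c * prob (\<Union>N. E N) \<le> prob D" by (rule Lim_bounded) (use E in auto)
  also have "(\<Union>N. E N) = {q \<in> space M. \<exists>n\<ge>1. visits T D n q \<ge> c * real n}"
    unfolding E_def by fastforce
  finally show ?thesis .
qed

end

section \<open>The Lyapunov exponent of a cocycle\<close>

lemma ext_log_rate_le:
  assumes "t > 0" "0 \<le> x" "x \<le> exp (r * t)"
  shows "ereal (1 / t) * ext_log x \<le> ereal r"
proof (cases "x = 0")
  case False
  then have "ln x \<le> r * t" using assms ln_le_cancel_iff[of x "exp (r * t)"] by simp
  then show ?thesis using assms False by (simp add: ext_log_def field_simps)
qed (use assms in \<open>simp add: ext_log_def\<close>)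

lemma ext_log_rate_ge:
  assumes "t > 0" "x \<ge> exp (r * t)"
  shows "ereal r \<le> ereal (1 / t) * ext_log x"
proof -
  have "x > 0" using assms(2) by (rule less_le_trans[rotated]) simp
  with assms have "r * t \<le> ln x" by (simp add: ln_ge_iff)
  then show ?thesis using assms \<open>x > 0\<close> by (simp add: ext_log_def field_simps)
qed

text \<open>The bound is written \<open>exp K\<close> with \<open>K \<ge> 0\<close> so that
  iterating it gives an exponential that increases in time.\<close>

locale ergodic_cocycle = prob_space M for M :: "'m::metric_space measure" +
  fixes \<phi> :: "real \<Rightarrow> 'm \<Rightarrow> 'm"
    and A :: "'m \<Rightarrow> real \<Rightarrow> 'x::real_normed_vector \<Rightarrow>\<^sub>L 'x"
    and K :: real
  assumes semi_flow: "semi_flow \<phi>"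
    and cocycle: "cocycle \<phi> A"
    and sets_M: "sets M = sets borel"
    and ergodic: "ergodic_measure \<phi> M"
    and K_nonneg: "K \<ge> 0"
    and local_bound: "\<And>q t. 0 \<le> t \<Longrightarrow> t \<le> 1 \<Longrightarrow> norm (A q t) \<le> exp K"
begin

lemma space_M [simp]: "space M = UNIV"
  using sets_eq_imp_space_eq[OF sets_M] by simp

lemma flow_measurable: "s \<ge> 0 \<Longrightarrow> \<phi> s \<in> M \<rightarrow>\<^sub>M M"
  using borel_measurable_continuous_onI[OF semi_flow_continuous_on[OF semi_flow]]
  by (simp cong: measurable_cong_sets add: sets_M)

lemma flow_add: "s \<ge> 0 \<Longrightarrow> t \<ge> 0 \<Longrightarrow> \<phi> (t + s) q = \<phi> t (\<phi> s q)"
  using semi_flow by (simp add: semi_flow_def)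

lemma distr_flow: "s \<ge> 0 \<Longrightarrow> distr M M (\<phi> s) = M"
  using ergodic by (intro measure_eqI)
    (auto simp: emeasure_distr flow_measurable ergodic_measure_def invariant_measure_def)

sublocale measure_preserving M "\<phi> 1"
  by unfold_locales (auto simp: flow_measurable distr_flow)

lemma flow_of_nat: "\<phi> (real n) = \<phi> 1 ^^ n"
proof (induction n)
  case 0
  show ?case using semi_flow by (simp add: semi_flow_def id_def)
next
  case (Suc n)
  then show ?case using flow_add[of "real n" 1] by (auto simp: fun_eq_iff add.commute)
qed

lemma cocycle_add: "s \<ge> 0 \<Longrightarrow> t \<ge> 0 \<Longrightarrow> A q (t + s) = A (\<phi> s q) t o\<^sub>L A q s"
  using cocycle by (simp add: cocycle_def)

lemma cocycle_0: "A q 0 = id_blinfun"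
  using cocycle by (simp add: cocycle_def)

lemma norm_cocycle_add:
  "s \<ge> 0 \<Longrightarrow> t \<ge> 0 \<Longrightarrow> norm (A q (t + s)) \<le> norm (A (\<phi> s q) t) * norm (A q s)"
  by (simp add: cocycle_add norm_blinfun_compose)

text \<open>The operators need not be invertible, so norms are controlled only forward in time. This
  decides below whether a real time is rounded down or up.\<close>

lemma norm_cocycle_short:
  assumes "0 \<le> s" "s \<le> t" "t \<le> s + 1"
  shows "norm (A q t) \<le> exp K * norm (A q s)"
proof -
  have "norm (A q (t - s + s)) \<le> norm (A (\<phi> s q) (t - s)) * norm (A q s)"
    using assms by (intro norm_cocycle_add) auto
  also have "\<dots> \<le> exp K * norm (A q s)"
    using assms by (intro mult_right_mono local_bound) auto
  finally show ?thesis by simp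
qed

lemma norm_cocycle_le:
  assumes "t \<ge> 0"
  shows "norm (A q t) \<le> exp (K * (t + 1))"
proof -
  have n: "norm (A q (real n)) \<le> exp (K * n)" for n
  proof (induction n)
    case 0
    then show ?case using norm_blinfun_id_le by (simp add: cocycle_0)
  next
    case (Suc n)
    have "norm (A q (real (Suc n))) \<le> exp K * norm (A q (real n))"
      by (rule norm_cocycle_short) auto
    also have "\<dots> \<le> exp K * exp (K * n)" using Suc by simp
    finally show ?case by (simp add: exp_add[symmetric] algebra_simps)
  qed
  define n where "n = nat \<lfloor>t\<rfloor>"
  have "real n \<le> t" "t \<le> real n + 1" using assms unfolding n_def by linarith+
  then have "norm (A q t) \<le> exp K * norm (A q (real n))" by (intro norm_cocycle_short) auto
  also have "\<dots> \<le> exp K * exp (K * n)" using n by simp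
  also have "\<dots> = exp (K * (n + 1))" by (simp add: exp_add[symmetric] algebra_simps)
  also have "\<dots> \<le> exp (K * (t + 1))" using \<open>real n \<le> t\<close> K_nonneg by (simp add: mult_left_mono)
  finally show ?thesis .
qed

lemma norm_cocycle_measurable [measurable]: "t \<ge> 0 \<Longrightarrow> (\<lambda>q. norm (A q t)) \<in> borel_measurable M"
  using cocycle_norm_measurable[OF cocycle] by (simp cong: measurable_cong_sets add: sets_M)

text \<open>Replacing \<open>E\<close> by the intersection of its preimages under the integer times makes it strictly
  invariant without changing its measure.\<close>

lemma zero_one:
  assumes E: "E \<in> events" and sub: "\<And>s q. s \<ge> 0 \<Longrightarrow> \<phi> s q \<in> E \<Longrightarrow> q \<in> E"
  shows "prob E = 0 \<or> prob E = 1"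
proof -
  define F where "F n = \<phi> (real n) -` E" for n :: nat
  have prob_F: "prob (F n) = prob E" for n
    using prob_funpow_vimage[OF E, of n] by (simp add: F_def flow_of_nat)
  have F_meas: "F n \<in> events" for n
    using measurable_sets[OF flow_measurable E, of "real n"] by (simp add: F_def)
  \<comment> \<open>An orbit that is in \<open>E\<close> at some time was in \<open>E\<close> at all
    earlier times, so the sets \<open>F n\<close> decrease.\<close>
  have shift: "\<phi> s q \<in> E" if "\<phi> t q \<in> E" "0 \<le> s" "s \<le> t" for s t q
    using that sub[of "t - s" "\<phi> s q"] flow_add[of s "t - s" q] by simp
  have "decseq F" unfolding decseq_def F_def
    by (safe, simp, rule shift) auto
  then have "(\<lambda>n. prob (F n)) \<longlonglongrightarrow> prob (\<Inter>n. F n)"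
    by (intro finite_Lim_measure_decseq) (auto simp: F_meas)
  then have prob_E: "prob E = prob (\<Inter>n. F n)" by (simp add: prob_F LIMSEQ_const_iff)
  have "\<phi> s -` (\<Inter>n. F n) = (\<Inter>n. F n)" if "s \<ge> 0" for s
  proof -
    \<comment> \<open>By \<open>shift\<close>, being in \<open>E\<close> at all integer times is the
      same as being there at all real times; this gives invariance under every real
      \<open>s\<close>, as the definition of ergodicity demands.\<close>
    have "(\<forall>n. \<phi> (real n) (\<phi> s q) \<in> E) \<longleftrightarrow> (\<forall>n. \<phi> (real n) q \<in> E)" for q
    proof
      assume "\<forall>n. \<phi> (real n) (\<phi> s q) \<in> E"
      then show "\<forall>n. \<phi> (real n) q \<in> E"
        using that shift[of "real n + s" _ "real n" for n] by (simp add: flow_add)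
    next
      assume *: "\<forall>n. \<phi> (real n) q \<in> E"
      show "\<forall>n. \<phi> (real n) (\<phi> s q) \<in> E"
      proof
        fix n
        have "\<phi> (real (n + nat \<lceil>s\<rceil>)) q \<in> E" using * by blast
        moreover have "real n + s \<le> real (n + nat \<lceil>s\<rceil>)" using that by simp
        moreover have "0 \<le> real n + s" using that by simp
        ultimately have "\<phi> (real n + s) q \<in> E" by (blast intro: shift)
        then show "\<phi> (real n) (\<phi> s q) \<in> E" using that by (simp add: flow_add)
      qed
    qed
    then show ?thesis by (auto simp: F_def)
  qed
  moreover have "(\<Inter>n. F n) \<in> events" using F_meas by auto
  ultimately have "emeasure M (\<Inter>n. F n) = 0 \<or> emeasure M (\<Inter>n. F n) = 1"
    using ergodic unfolding ergodic_measure_def by simp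
  then show ?thesis unfolding prob_E by (auto simp: measure_def)
qed

section \<open>Growth rates along orbits and their zero-one laws\<close>

definition growth_le :: "real \<Rightarrow> 'm set" where
  "growth_le r = {q. \<exists>c. \<forall>t\<ge>0. norm (A q t) \<le> c * exp (r * t)}"

text \<open>These two sets play the roles of limsup and liminf bounds on the rate. The constant may
  depend on the point, so membership of \<open>\<phi> s q\<close> implies that of \<open>q\<close>,
  as \<open>zero_one\<close> requires.\<close>

definition freq_growth_le :: "real \<Rightarrow> 'm set" where
  "freq_growth_le r = {q. \<exists>c. \<forall>s. \<exists>t\<ge>s. norm (A q t) \<le> c * exp (r * t)}"

lemma growth_le_mono:
  assumes "r \<le> r'"
  shows "growth_le r \<subseteq> growth_le r'"
proof
  fix q assume "q \<in> growth_le r"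
  then obtain c where c: "\<And>t. t \<ge> 0 \<Longrightarrow> norm (A q t) \<le> c * exp (r * t)"
    by (auto simp: growth_le_def)
  have "c \<ge> 0" using order_trans[OF norm_ge_zero c[of 0]] by simp
  then have "c * exp (r * t) \<le> c * exp (r' * t)" if "t \<ge> 0" for t
    using that assms by (intro mult_left_mono) (auto simp: mult_right_mono)
  with c show "q \<in> growth_le r'" unfolding growth_le_def using order_trans by blast
qed

text \<open>Rounding a time down to an integer costs a factor \<open>exp K\<close> for the cocycle
  and at most \<open>exp \<bar>r\<bar>\<close> for the exponential. Time 0 is left out because the
  frequency bounds used later hold for \<open>n \<ge> 1\<close>; raising the constant to at least 1
  restores it.\<close>

lemma growth_leI:
  assumes "\<And>n. n \<ge> 1 \<Longrightarrow> norm (A q (real n)) \<le> c * exp (r * real n)"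
  shows "q \<in> growth_le r"
proof -
  define c' where "c' = max c 1"
  have c': "norm (A q (real n)) \<le> c' * exp (r * real n)" for n
  proof (cases "n = 0")
    case True
    then show ?thesis using norm_blinfun_id_le by (auto simp: cocycle_0 c'_def le_max_iff_disj)
  next
    case False
    then have "norm (A q (real n)) \<le> c * exp (r * real n)" by (intro assms) auto
    also have "\<dots> \<le> c' * exp (r * real n)" by (simp add: c'_def)
    finally show ?thesis .
  qed
  have "norm (A q t) \<le> (exp K * c' * exp \<bar>r\<bar>) * exp (r * t)" if "t \<ge> 0" for t
  proof -
    define n where "n = nat \<lfloor>t\<rfloor>"
    have n: "real n \<le> t" "t \<le> real n + 1" using that unfolding n_def by linarith+
    then have "norm (A q t) \<le> exp K * norm (A q (real n))" by (intro norm_cocycle_short) auto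
    also have "\<dots> \<le> exp K * (c' * exp (r * real n))" using c' by simp
    also have "c' * exp (r * real n) \<le> c' * exp (\<bar>r\<bar> + r * t)"
    proof -
      have "\<bar>r * (real n - t)\<bar> \<le> \<bar>r\<bar> * 1" unfolding abs_mult using n by (intro mult_left_mono) auto
      then have "r * real n \<le> \<bar>r\<bar> + r * t" by (simp add: algebra_simps abs_le_iff)
      then show ?thesis unfolding c'_def by (intro mult_left_mono) auto
    qed
    finally show ?thesis by (simp add: exp_add mult.assoc)
  qed
  then show ?thesis unfolding growth_le_def by blast
qed

lemma growth_le_iff:
  "q \<in> growth_le r \<longleftrightarrow> (\<exists>c::nat. \<forall>n::nat. norm (A q (real n)) \<le> real c * exp (r * real n))"
proof
  assume "q \<in> growth_le r"
  then obtain c where c: "\<And>t. t \<ge> 0 \<Longrightarrow> norm (A q t) \<le> c * exp (r * t)"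
    by (auto simp: growth_le_def)
  obtain c' :: nat where "c \<le> real c'" using real_arch_simple by blast
  then have "c * exp (r * n) \<le> c' * exp (r * n)" for n by simp
  then show "\<exists>c::nat. \<forall>n::nat. norm (A q (real n)) \<le> real c * exp (r * real n)"
    using c by (meson of_nat_0_le_iff order_trans)
qed (blast intro: growth_leI)

text \<open>Integer times and constants make the set measurable. Times are rounded up here, since a
  small norm at time \<open>t\<close> forces small norms only shortly after
  \<open>t\<close>.\<close>

lemma freq_growth_le_iff:
  "q \<in> freq_growth_le r \<longleftrightarrow>
    (\<exists>c::nat. \<forall>m::nat. \<exists>n::nat\<ge>m. norm (A q (real n)) \<le> real c * exp (r * real n))"
proof
  assume "q \<in> freq_growth_le r"
  then obtain c where c: "\<And>s. \<exists>t\<ge>s. norm (A q t) \<le> c * exp (r * t)"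
    by (auto simp: freq_growth_le_def)
  obtain c' :: nat where c': "exp K * (\<bar>c\<bar> * exp \<bar>r\<bar>) \<le> real c'" using real_arch_simple by blast
  have "\<exists>n\<ge>m. norm (A q (real n)) \<le> real c' * exp (r * real n)" for m
  proof -
    obtain t where t: "t \<ge> real m" "norm (A q t) \<le> c * exp (r * t)" using c by blast
    define n where "n = nat \<lceil>t\<rceil>"
    have n: "t \<le> real n" "real n \<le> t + 1" using t unfolding n_def by linarith+
    have "norm (A q (real n)) \<le> exp K * norm (A q t)"
      using n t by (intro norm_cocycle_short) auto
    also have "norm (A q t) \<le> \<bar>c\<bar> * exp (\<bar>r\<bar> + r * n)"
    proof -
      have "\<bar>r * (t - real n)\<bar> \<le> \<bar>r\<bar> * 1" unfolding abs_mult using n by (intro mult_left_mono) auto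
      then have "r * t \<le> \<bar>r\<bar> + r * n" by (simp add: algebra_simps abs_le_iff)
      then have "\<bar>c\<bar> * exp (r * t) \<le> \<bar>c\<bar> * exp (\<bar>r\<bar> + r * n)" by (intro mult_left_mono) auto
      moreover have "c * exp (r * t) \<le> \<bar>c\<bar> * exp (r * t)" by simp
      ultimately show ?thesis using t(2) by linarith
    qed
    also have "exp K * (\<bar>c\<bar> * exp (\<bar>r\<bar> + r * n)) = (exp K * (\<bar>c\<bar> * exp \<bar>r\<bar>)) * exp (r * n)"
      by (simp add: exp_add)
    also have "\<dots> \<le> real c' * exp (r * n)" using c' by simp
    finally have "norm (A q (real n)) \<le> real c' * exp (r * real n)" by simp
    moreover have "n \<ge> m" using n t by simp
    ultimately show ?thesis by blast
  qed
  then show "\<exists>c::nat. \<forall>m::nat. \<exists>n::nat\<ge>m. norm (A q (real n)) \<le> real c * exp (r * real n)"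
    by blast
next
  assume "\<exists>c::nat. \<forall>m::nat. \<exists>n::nat\<ge>m. norm (A q (real n)) \<le> real c * exp (r * real n)"
  then obtain c :: nat
    where c: "\<And>m. \<exists>n\<ge>m. norm (A q (real n)) \<le> real c * exp (r * real n)" by blast
  have "\<exists>t\<ge>s. norm (A q t) \<le> c * exp (r * t)" for s
    using c[of "nat \<lceil>s\<rceil>"] by (metis nat_ceiling_le_eq)
  then show "q \<in> freq_growth_le r" unfolding freq_growth_le_def by blast
qed

lemma growth_le_measurable [measurable]: "growth_le r \<in> events"
proof -
  have "{q \<in> space M. \<exists>c::nat. \<forall>n::nat. norm (A q (real n)) \<le> real c * exp (r * real n)} \<in> events"
    by measurable
  then show ?thesis by (simp add: growth_le_iff[symmetric])
qed

lemma freq_growth_le_measurable [measurable]: "freq_growth_le r \<in> events"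
proof -
  have "{q \<in> space M. \<exists>c::nat. \<forall>m::nat. \<exists>n::nat\<in>{m..}.
      norm (A q (real n)) \<le> real c * exp (r * real n)} \<in> events"
    by measurable
  then show ?thesis by (simp add: freq_growth_le_iff[symmetric] Bex_def)
qed

lemma growth_le_zero_one: "prob (growth_le r) = 0 \<or> prob (growth_le r) = 1"
proof (rule zero_one)
  fix s q assume s: "s \<ge> 0" and "\<phi> s q \<in> growth_le r"
  then obtain c where c: "\<And>t. t \<ge> 0 \<Longrightarrow> norm (A (\<phi> s q) t) \<le> c * exp (r * t)"
    by (auto simp: growth_le_def)
  define a where "a = exp (K * (s + 1))"
  \<comment> \<open>The first entry serves \<open>t \<ge> s\<close>, where the cocycle splits at
    time \<open>s\<close>; the second serves \<open>t < s\<close>, where \<open>a\<close> bounds the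
    norm and \<open>exp (\<bar>r\<bar> * s)\<close> makes up for \<open>exp (r * t)\<close>.\<close>
  define c' where "c' = max (c * exp (- r * s) * a) (a * exp (\<bar>r\<bar> * s))"
  have "norm (A q t) \<le> c' * exp (r * t)" if "t \<ge> 0" for t
  proof (cases "t \<ge> s")
    case True
    have "norm (A q (t - s + s)) \<le> norm (A (\<phi> s q) (t - s)) * norm (A q s)"
      using s True by (intro norm_cocycle_add) auto
    also have "\<dots> \<le> (c * exp (r * (t - s))) * a"
      using c[of "t - s"] norm_cocycle_le[OF s] True order_trans[OF norm_ge_zero c[of "t - s"]]
      unfolding a_def by (intro mult_mono) auto
    also have "\<dots> = (c * exp (- r * s) * a) * exp (r * t)"
      by (simp add: right_diff_distrib exp_diff exp_minus field_simps)
    also have "\<dots> \<le> c' * exp (r * t)" by (simp add: c'_def)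
    finally show ?thesis by simp
  next
    case False
    have "norm (A q t) \<le> exp (K * (t + 1))" by (rule norm_cocycle_le[OF that])
    also have "\<dots> \<le> a" unfolding a_def using False K_nonneg by (simp add: mult_left_mono)
    also have "\<dots> \<le> a * exp (\<bar>r\<bar> * s + r * t)"
    proof -
      have "\<bar>r * t\<bar> \<le> \<bar>r\<bar> * s" unfolding abs_mult using that False by (intro mult_left_mono) auto
      then have "exp (\<bar>r\<bar> * s + r * t) \<ge> 1" by simp
      then show ?thesis by (simp add: a_def)
    qed
    also have "\<dots> = (a * exp (\<bar>r\<bar> * s)) * exp (r * t)" by (simp add: exp_add)
    also have "\<dots> \<le> c' * exp (r * t)" by (simp add: c'_def)
    finally show ?thesis .
  qed
  then show "q \<in> growth_le r" unfolding growth_le_def by blast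
qed measurable

lemma freq_growth_le_zero_one: "prob (freq_growth_le r) = 0 \<or> prob (freq_growth_le r) = 1"
proof (rule zero_one)
  fix s q assume s: "s \<ge> 0" and "\<phi> s q \<in> freq_growth_le r"
  then obtain c where c: "\<And>u. \<exists>t\<ge>u. norm (A (\<phi> s q) t) \<le> c * exp (r * t)"
    by (auto simp: freq_growth_le_def)
  define a where "a = exp (K * (s + 1))"
  have "\<exists>t\<ge>u. norm (A q t) \<le> c * exp (- r * s) * a * exp (r * t)" for u
  proof -
    obtain t where t: "t \<ge> max 0 u" "norm (A (\<phi> s q) t) \<le> c * exp (r * t)" using c by blast
    have "norm (A q (t + s)) \<le> norm (A (\<phi> s q) t) * norm (A q s)"
      using s t by (intro norm_cocycle_add) auto
    also have "\<dots> \<le> (c * exp (r * t)) * a"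
      using t norm_cocycle_le[OF s] order_trans[OF norm_ge_zero t(2)]
      unfolding a_def by (intro mult_mono) auto
    also have "\<dots> = c * exp (- r * s) * a * exp (r * (t + s))"
      by (simp add: distrib_left exp_add exp_minus field_simps)
    finally show ?thesis using t s by (intro exI[of _ "t + s"]) auto
  qed
  then show "q \<in> freq_growth_le r" unfolding freq_growth_le_def by blast
qed measurable

text \<open>Through the zero-one law, an almost sure rate needs to be found only on a set of
  positive measure.\<close>

lemma prob_growth_le_eq_1:
  assumes "AE q in M. q \<in> Z \<longrightarrow> q \<in> growth_le r" "prob Z > 0"
  shows "prob (growth_le r) = 1"
proof -
  have "prob Z \<le> prob (growth_le r)" using assms by (intro finite_measure_mono_AE) auto
  then show ?thesis using assms(2) growth_le_zero_one[of r] by linarith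
qed

text \<open>The core of Kingman's theorem. The gap between \<open>r\<close> and the intermediate
  rate \<open>r1\<close> absorbs the constant of the frequent growth bound, the gap between
  \<open>r1\<close> and \<open>r'\<close> the rare visits to points without a good block.\<close>

lemma prob_growth_le_of_freq:
  assumes freq: "prob (freq_growth_le r) = 1" and "r < r'"
  shows "prob (growth_le r') = 1"
proof -
  define r1 where "r1 = (r + r') / 2"
  have r1: "r < r1" "r1 < r'" using assms(2) by (auto simp: r1_def field_simps)
  \<comment> \<open>A point in every \<open>D N\<close> never grows at rate \<open>r1\<close> or
    less, so it lies outside \<open>freq_growth_le r\<close>; hence the measure of
    \<open>D N\<close> tends to 0.\<close>
  define D where "D N = {q \<in> space M. \<not> (\<exists>l\<in>{1..N}. norm (A q (real l)) \<le> exp (r1 * real l))}" for N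
  have D_meas [measurable]: "D N \<in> events" for N unfolding D_def by measurable
  have "(\<Inter>N. D N) \<subseteq> space M - freq_growth_le r"
  proof -
    have "\<exists>N. q \<notin> D N" if q: "q \<in> freq_growth_le r" for q
    proof -
      obtain c :: nat where c: "\<And>m. \<exists>n\<ge>m. norm (A q (real n)) \<le> real c * exp (r * real n)"
        using q unfolding freq_growth_le_iff by blast
      obtain m :: nat where m: "real c / (r1 - r) \<le> real m" using real_arch_simple by blast
      obtain n where n: "n \<ge> m + 1" "norm (A q (real n)) \<le> real c * exp (r * real n)" using c by blast
      have "real c / (r1 - r) \<le> real n" using m n by simp
      then have "real c \<le> (r1 - r) * real n" using r1 by (simp add: field_simps)
      also have "\<dots> \<le> exp ((r1 - r) * real n)"
        using exp_ge_add_one_self[of "(r1 - r) * real n"] by linarith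
      finally have "real c * exp (r * real n) \<le> exp ((r1 - r) * real n) * exp (r * real n)" by simp
      also have "\<dots> = exp (r1 * real n)" by (simp add: exp_add[symmetric] algebra_simps)
      finally have "norm (A q (real n)) \<le> exp (r1 * real n)" using n by linarith
      then have "q \<notin> D n" using n by (auto simp: D_def)
      then show ?thesis by blast
    qed
    then show ?thesis by auto
  qed
  then have "prob (\<Inter>N. D N) \<le> prob (space M - freq_growth_le r)"
    by (intro finite_measure_mono sets.compl_sets freq_growth_le_measurable)
  then have "prob (\<Inter>N. D N) = 0"
    using prob_compl[of "freq_growth_le r"] freq by (simp add: measure_le_0_iff)
  moreover have "decseq D" unfolding decseq_def D_def by force
  ultimately have lim: "(\<lambda>N. prob (D N)) \<longlonglongrightarrow> 0"
    using finite_Lim_measure_decseq[of D] D_meas by (auto simp: image_subset_iff)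
  \<comment> \<open>\<open>\<kappa>\<close> is the cost per visit in the greedy bound, with
    \<open>+ 1\<close> to keep it positive. Visits to \<open>D N\<close> with frequency
    \<open>c\<close> raise the rate from \<open>r1\<close> to exactly \<open>r'\<close>.\<close>
  define \<kappa> where "\<kappa> = \<bar>K\<bar> + \<bar>r1\<bar> + 1"
  define c where "c = (r' - r1) / \<kappa>"
  have "\<kappa> > 0" unfolding \<kappa>_def by linarith
  then have "c > 0" using r1 by (simp add: c_def)
  then have "eventually (\<lambda>N. prob (D N) < c) sequentially" using lim by (intro order_tendstoD(2))
  then obtain N where N: "prob (D N) < c" using eventually_happens'[OF sequentially_bot] by blast
  \<comment> \<open>Outside \<open>Z\<close> the visit frequency stays below \<open>c\<close> at all
    times, and the maximal inequality leaves a complement of positive measure.\<close>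
  define Z where "Z = {q \<in> space M. \<exists>n\<ge>1. visits (\<phi> 1) (D N) n q \<ge> c * real n}"
  have [measurable]: "Z \<in> events" unfolding Z_def by measurable
  have "c * prob Z < c * 1"
    using maximal_inequality[OF D_meas \<open>c > 0\<close>, of N] N unfolding Z_def by simp
  then have "prob (space M - Z) > 0" using \<open>c > 0\<close> by (subst prob_compl) auto
  moreover have "q \<in> growth_le r'" if "q \<in> space M - Z" for q
  proof (rule growth_leI)
    fix n :: nat assume "n \<ge> 1"
    have "norm (A q (real n)) \<le> exp (r1 * real n + \<kappa> * (visits (\<phi> 1) (D N) n q + real N))"
    proof (rule submultiplicative_greedy_bound[where a = "\<lambda>q n. norm (A q (real n))" and k = K])
      fix q and m n :: nat
      show "norm (A q (real (m + n)))
          \<le> norm (A ((\<phi> 1 ^^ m) q) (real n)) * norm (A q (real m))"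
        using norm_cocycle_add[of "real m" "real n" q] by (simp add: flow_of_nat add.commute)
    next
      show "norm (A q (real 0)) \<le> 1" for q using norm_blinfun_id_le by (simp add: cocycle_0)
      show "norm (A q (real 1)) \<le> exp K" for q by (rule local_bound) auto
    qed (auto simp: \<kappa>_def D_def)
    also have "\<kappa> * (visits (\<phi> 1) (D N) n q + real N) \<le> \<kappa> * (c * real n + real N)"
    proof (intro mult_left_mono add_right_mono)
      have "\<not> c * real n \<le> visits (\<phi> 1) (D N) n q" using that \<open>n \<ge> 1\<close> unfolding Z_def by blast
      then show "visits (\<phi> 1) (D N) n q \<le> c * real n" by simp
    qed (use \<open>\<kappa> > 0\<close> in simp)
    also have "r1 * real n + \<kappa> * (c * real n + real N) = \<kappa> * N + r' * n"
      using \<open>\<kappa> > 0\<close> by (simp add: c_def field_simps)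
    finally show "norm (A q (real n)) \<le> exp (\<kappa> * N) * exp (r' * real n)"
      by (simp add: exp_add)
  qed
  ultimately show ?thesis by (intro prob_growth_le_eq_1[of "space M - Z"]) auto
qed

section \<open>The exponent as an almost sure limit\<close>

definition exponent :: ereal where
  "exponent = Inf (ereal ` {r. prob (growth_le r) = 1})"

lemma exponent_le: "prob (growth_le r) = 1 \<Longrightarrow> exponent \<le> ereal r"
  unfolding exponent_def by (intro Inf_lower) auto

lemma AE_growth_le:
  assumes "exponent < ereal r"
  shows "AE q in M. q \<in> growth_le r"
proof -
  obtain r0 where r0: "r0 < r" "prob (growth_le r0) = 1"
    using assms by (auto simp: exponent_def Inf_less_iff)
  have "AE q in M. q \<in> growth_le r0" using r0(2) by (simp add: prob_eq_1)
  then show ?thesis using growth_le_mono[of r0 r] r0(1) by (auto elim: eventually_mono)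
qed

text \<open>Otherwise a rate strictly between \<open>r\<close> and the exponent would hold almost
  surely for all times, contradicting the infimum.\<close>

lemma AE_not_freq_growth_le:
  assumes "ereal r < exponent"
  shows "AE q in M. q \<notin> freq_growth_le r"
proof -
  have "prob (freq_growth_le r) \<noteq> 1"
  proof
    assume *: "prob (freq_growth_le r) = 1"
    obtain r' where "ereal r < ereal r'" "ereal r' < exponent"
      using assms ereal_dense2 by blast
    then show False using prob_growth_le_of_freq[OF *, of r'] exponent_le[of r'] by auto
  qed
  then have "prob (freq_growth_le r) = 0" using freq_growth_le_zero_one by blast
  then show ?thesis by (simp add: prob_eq_0)
qed

text \<open>Rational rates leave only countably many null sets. Rates above the exponent bound the
  limsup, rates below it the liminf.\<close>

lemma has_lyapunov_exponent_exponent: "has_lyapunov_exponent M A exponent"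
  unfolding has_lyapunov_exponent_def
proof -
  have "AE q in M. \<forall>r::rat. (exponent < ereal (real_of_rat r) \<longrightarrow> q \<in> growth_le (real_of_rat r)) \<and>
      (ereal (real_of_rat r) < exponent \<longrightarrow> q \<notin> freq_growth_le (real_of_rat r))"
    unfolding AE_all_countable
  proof
    fix r :: rat
    show "AE q in M. (exponent < ereal (real_of_rat r) \<longrightarrow> q \<in> growth_le (real_of_rat r)) \<and>
      (ereal (real_of_rat r) < exponent \<longrightarrow> q \<notin> freq_growth_le (real_of_rat r))"
      using AE_growth_le AE_not_freq_growth_le
      by (cases "exponent < ereal (real_of_rat r)"; cases "ereal (real_of_rat r) < exponent") auto
  qed
  then show "AE q in M. ((\<lambda>t. ereal (1 / t) * ext_log (norm (A q t))) \<longlongrightarrow> exponent) at_top"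
  proof eventually_elim
    case (elim q)
    show ?case
    proof (rule order_tendstoI)
      fix a assume "a < exponent"
      then obtain r :: rat where r: "a < ereal (real_of_rat r)" "ereal (real_of_rat r) < exponent"
        using ereal_dense3 by blast
      then have "q \<notin> freq_growth_le (real_of_rat r)" using elim by blast
      then have "\<not> (\<exists>c. \<forall>s. \<exists>t\<ge>s. norm (A q t) \<le> c * exp (real_of_rat r * t))"
        unfolding freq_growth_le_def by simp
      \<comment> \<open>Take the constant 1 in the negated definition.\<close>
      then obtain s where s: "\<And>t. t \<ge> s \<Longrightarrow> exp (real_of_rat r * t) < norm (A q t)"
        by (metis mult_1 not_le)
      show "eventually (\<lambda>t. a < ereal (1 / t) * ext_log (norm (A q t))) at_top"
        using eventually_ge_at_top[of s] eventually_gt_at_top[of 0]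
      proof eventually_elim
        case (elim t)
        then have "ereal (real_of_rat r) \<le> ereal (1 / t) * ext_log (norm (A q t))"
          using s[of t] by (intro ext_log_rate_ge) auto
        with r(1) show ?case by (rule less_le_trans)
      qed
    next
      fix a assume a: "exponent < a"
      obtain r :: rat where r: "exponent < ereal (real_of_rat r)" "ereal (real_of_rat r) < a"
        using ereal_dense3[OF a] by blast
      \<comment> \<open>The room between \<open>r\<close> and \<open>r'\<close> absorbs the constant
        \<open>c\<close> once \<open>t\<close> reaches \<open>c / (r' - r)\<close>.\<close>
      obtain r' where r': "real_of_rat r < r'" "ereal r' < a" using ereal_dense2[OF r(2)] by auto
      have "q \<in> growth_le (real_of_rat r)" using elim r by blast
      then obtain c where c: "\<And>t. t \<ge> 0 \<Longrightarrow> norm (A q t) \<le> c * exp (real_of_rat r * t)"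
        unfolding growth_le_def by blast
      show "eventually (\<lambda>t. ereal (1 / t) * ext_log (norm (A q t)) < a) at_top"
        using eventually_ge_at_top[of "c / (r' - real_of_rat r)"] eventually_gt_at_top[of 0]
      proof eventually_elim
        case (elim t)
        have "c \<le> (r' - real_of_rat r) * t" using elim(1) r' by (simp add: field_simps)
        also have "\<dots> \<le> exp ((r' - real_of_rat r) * t)"
          using exp_ge_add_one_self[of "(r' - real_of_rat r) * t"] by linarith
        finally have "c * exp (real_of_rat r * t)
            \<le> exp ((r' - real_of_rat r) * t) * exp (real_of_rat r * t)" by simp
        also have "\<dots> = exp (r' * t)" by (simp add: exp_add[symmetric] algebra_simps)
        finally have "norm (A q t) \<le> exp (r' * t)" using c[of t] elim by linarith
        then have "ereal (1 / t) * ext_log (norm (A q t)) \<le> ereal r'"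
          using elim by (intro ext_log_rate_le) auto
        then show ?case using r'(2) by (rule le_less_trans)
      qed
    qed
  qed
qed

lemma largest_lyapunov_exponent: "largest_lyapunov_exponent M A = exponent"
  by (intro largest_lyapunov_exponent_eq has_lyapunov_exponent_exponent prob_space_axioms)

end

section \<open>Negativity of the exponent\<close>

lemma le_of_powr_le:
  fixes y z b p :: real
  assumes "p > 0" "y \<ge> 0" "z \<ge> 0" "b \<ge> 0" "y powr p \<le> b * z powr p"
  shows "y \<le> b powr (1 / p) * z"
proof -
  have "(y powr p) powr (1 / p) \<le> (b * z powr p) powr (1 / p)"
    using assms by (intro powr_mono2) auto
  then show ?thesis using assms by (simp add: powr_powr powr_mult)
qed

lemma visits_eq_of_nat: "\<exists>k::nat. visits T D n q = real k"
proof (induction n)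
  case (Suc n)
  then obtain k where "visits T D n q = real k" by blast
  then show ?case
    by (intro exI[of _ "k + (if (T ^^ n) q \<in> D then 1 else 0)"]) (simp add: visits_Suc)
qed (auto intro: exI[of _ 0])

text \<open>The time \<open>m\<close> is that of visit number \<open>N + 1\<close>: the count leaves
  out time \<open>m\<close> itself, so it equals \<open>N\<close> there.\<close>

lemma visits_reach:
  fixes N :: nat
  assumes "visits T D n q > N"
  shows "\<exists>m<n. visits T D m q = N \<and> (T ^^ m) q \<in> D"
  using assms
proof (induction n)
  case (Suc n)
  show ?case
  proof (cases "visits T D n q > N")
    case True
    with Suc.IH show ?thesis using less_Suc_eq by blast
  next
    case False
    obtain k where k: "visits T D n q = real k" using visits_eq_of_nat[of T D n q] by blast
    with False Suc.prems have "(T ^^ n) q \<in> D \<and> k = N"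
      by (cases "(T ^^ n) q \<in> D") (auto simp: visits_Suc)
    with k show ?thesis by blast
  qed
qed simp

context ergodic_cocycle
begin

lemma cocycle_apply_add:
  "s \<ge> 0 \<Longrightarrow> t \<ge> 0 \<Longrightarrow> A q (t + s) x = A (\<phi> s q) t (A q s x)"
  by (simp add: cocycle_add)

text \<open>The norm at an integer time is at most \<open>exp K\<close> times the norm at any moment
  of the unit interval before it. The sum therefore starts at time 1.\<close>

lemma sum_powr_le_integral:
  assumes "p > 0"
    and int: "set_integrable lborel {0..} (\<lambda>t. norm (A q t x) powr p)"
  shows "(\<Sum>k<n. norm (A q (real (Suc k)) x) powr p)
    \<le> exp (K * p) * (LBINT t:{0..<real n}. norm (A q t x) powr p)"
proof (induction n)
  case (Suc n)
  define g where "g t = norm (A q t x) powr p" for t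
  have int': "set_integrable lborel {a..<b} g" if "a \<ge> 0" for a b
    using int unfolding g_def by (rule set_integrable_subset) (use that in auto)
  have "g (real (Suc n)) \<le> exp (K * p) * g t" if t: "t \<in> {real n..<real (Suc n)}" for t
  proof -
    have "norm (A q (real (Suc n)) x) = norm (A (\<phi> t q) (real (Suc n) - t) (A q t x))"
      using cocycle_apply_add[of t "real (Suc n) - t" q x] t by simp
    also have "\<dots> \<le> norm (A (\<phi> t q) (real (Suc n) - t)) * norm (A q t x)" by (rule norm_blinfun)
    also have "\<dots> \<le> exp K * norm (A q t x)"
      using t by (intro mult_right_mono local_bound) auto
    finally have "g (real (Suc n)) \<le> (exp K * norm (A q t x)) powr p"
      unfolding g_def using assms by (intro powr_mono2) auto
    then show ?thesis by (simp add: g_def powr_mult exp_powr_real)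
  qed
  then have "(LBINT t:{real n..<real (Suc n)}. g (real (Suc n)))
      \<le> (LBINT t:{real n..<real (Suc n)}. exp (K * p) * g t)"
    by (intro set_integral_mono set_integrable_mult_right int') (auto simp: set_integrable_def)
  then have step: "g (real (Suc n)) \<le> exp (K * p) * (LBINT t:{real n..<real (Suc n)}. g t)"
    by (simp add: set_integral_const)
  have "(\<Sum>k<Suc n. g (real (Suc k)))
      \<le> exp (K * p) * (LBINT t:{0..<real n}. g t) + g (real (Suc n))"
    using Suc by (simp add: g_def)
  also have "\<dots> \<le> exp (K * p) * ((LBINT t:{0..<real n}. g t) + (LBINT t:{real n..<real (Suc n)}. g t))"
    using step by (simp add: distrib_left)
  also have "(LBINT t:{0..<real n}. g t) + (LBINT t:{real n..<real (Suc n)}. g t)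
      = (LBINT t:{0..<real n} \<union> {real n..<real (Suc n)}. g t)"
    by (intro set_integral_Un[symmetric] int') auto
  also have "{0..<real n} \<union> {real n..<real (Suc n)} = {0..<real (Suc n)}" by auto
  finally show ?case by (simp add: g_def)
qed (simp add: set_lebesgue_integral_def)

text \<open>The summand 1 is the term at time 0. Replacing \<open>c\<close> by the larger
  \<open>c'\<close> makes the bound uniform over points where \<open>C\<close> is bounded.\<close>

lemma sum_powr_le:
  assumes "p > 0"
    and int: "set_integrable lborel {0..} (\<lambda>t. norm (A q t x) powr p)"
    and bound: "(LBINT t:{0..}. norm (A q t x) powr p) powr (1 / p) \<le> c * norm x"
    and c: "0 \<le> c" "c \<le> c'"
  shows "(\<Sum>k<n. norm (A q (real k) x) powr p) \<le> (1 + exp (K * p) * c' powr p) * norm x powr p"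
proof -
  define I where "I = (LBINT t:{0..}. norm (A q t x) powr p)"
  have "I \<ge> 0" unfolding I_def set_lebesgue_integral_def by (intro integral_nonneg_AE) auto
  then have "I = (I powr (1 / p)) powr p" using assms(1) by (simp add: powr_powr)
  also have "\<dots> \<le> (c * norm x) powr p"
    using bound assms(1) unfolding I_def by (intro powr_mono2) auto
  also have "\<dots> \<le> (c' * norm x) powr p"
    using c assms(1) by (intro powr_mono2 mult_right_mono) auto
  also have "\<dots> = c' powr p * norm x powr p"
    using c by (simp add: powr_mult)
  finally have I: "I \<le> c' powr p * norm x powr p" .
  have "(\<Sum>k<n. norm (A q (real k) x) powr p) \<le> (\<Sum>k<Suc n. norm (A q (real k) x) powr p)"
    by simp
  also have "\<dots> = norm x powr p + (\<Sum>k<n. norm (A q (real (Suc k)) x) powr p)"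
    by (subst sum.lessThan_Suc_shift) (simp add: cocycle_0)
  also have "(\<Sum>k<n. norm (A q (real (Suc k)) x) powr p)
      \<le> exp (K * p) * (LBINT t:{0..<real n}. norm (A q t x) powr p)"
    by (rule sum_powr_le_integral[OF assms(1) int])
  also have "(LBINT t:{0..<real n}. norm (A q t x) powr p) \<le> I"
  proof -
    have "set_integrable lborel {0..<real n} (\<lambda>t. norm (A q t x) powr p)"
      by (rule set_integrable_subset[OF int]) auto
    then show ?thesis
      using int unfolding I_def set_lebesgue_integral_def set_integrable_def
      by (intro integral_mono) (auto split: split_indicator)
  qed
  also note I
  finally show ?thesis by (simp add: algebra_simps)
qed

text \<open>Datko's argument along an orbit: every visit to \<open>S\<close> before time \<open>n\<close> bounds the norm at time
  \<open>n\<close> by the norm at the time of the visit, and these norms have a bounded sum. So the cocycle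
  contracts by a factor \<open>exp (- 1)\<close> over each \<open>N\<close> consecutive visits.\<close>

lemma norm_le_exp_visits:
  fixes N :: nat and B p :: real
  assumes p: "p > 0" and B: "B \<ge> 1" and N: "B\<^sup>2 * exp p \<le> real N"
    and S: "\<And>q x n. q \<in> S \<Longrightarrow> (\<Sum>k<n. norm (A q (real k) x) powr p) \<le> B * norm x powr p"
    and q: "q \<in> S"
  shows "norm (A q (real n)) \<le> B powr (1 / p) * exp (1 - visits (\<phi> 1) S n q / N)"
proof -
  have "0 < B\<^sup>2 * exp p" using B by simp
  then have N0: "real N > 0" using N by linarith
  have pointwise: "norm (A q (real n) x) powr p \<le> B * norm x powr p" if "q \<in> S" for q n x
  proof -
    have "norm (A q (real n) x) powr p \<le> (\<Sum>k<Suc n. norm (A q (real k) x) powr p)"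
      by (simp add: sum_nonneg)
    with S[OF that, of x "Suc n"] show ?thesis by linarith
  qed
  have bounded: "norm (A q (real n)) \<le> B powr (1 / p)" if "q \<in> S" for q n
    using pointwise[OF that] B p by (intro norm_blinfun_bound le_of_powr_le) auto
  \<comment> \<open>Summing over the visits gives
    \<open>visits * y \<le> B\<^sup>2 * norm x powr p\<close>. The choice of \<open>N\<close> turns
    this into a factor \<open>exp (- p)\<close> for p-th powers, hence \<open>exp (- 1)\<close> for
    norms.\<close>
  have contract: "norm (A q (real n)) \<le> exp (- 1)" if q: "q \<in> S" "visits (\<phi> 1) S n q \<ge> N" for q n
  proof -
    have "norm (A q (real n) x) powr p \<le> exp (- p) * norm x powr p" for x
    proof -
      define y where "y = norm (A q (real n) x) powr p"
      have "indicator S ((\<phi> 1 ^^ k) q) * y \<le> B * norm (A q (real k) x) powr p" if "k < n" for k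
      proof (cases "(\<phi> 1 ^^ k) q \<in> S")
        case True
        have "A q (real n) x = A ((\<phi> 1 ^^ k) q) (real (n - k)) (A q (real k) x)"
          using that cocycle_apply_add[of "real k" "real (n - k)" q x]
          by (simp add: flow_of_nat of_nat_diff)
        then show ?thesis using pointwise[OF True, of "n - k" "A q (real k) x"] True
          by (simp add: y_def)
      qed (use B in simp)
      then have "visits (\<phi> 1) S n q * y \<le> (\<Sum>k<n. B * norm (A q (real k) x) powr p)"
        unfolding visits_def sum_distrib_right by (intro sum_mono) auto
      also have "\<dots> \<le> B * (B * norm x powr p)"
        unfolding sum_distrib_left[symmetric] using S[OF q(1)] B by (intro mult_left_mono) auto
      finally have "visits (\<phi> 1) S n q * y \<le> B\<^sup>2 * norm x powr p"
        by (simp add: power2_eq_square mult.assoc)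
      moreover have "B\<^sup>2 * exp p * y \<le> visits (\<phi> 1) S n q * y"
        using N q(2) by (intro mult_right_mono) (auto simp: y_def)
      ultimately have "B\<^sup>2 * (exp p * y) \<le> B\<^sup>2 * norm x powr p" by simp
      then have "exp p * y \<le> norm x powr p" using B by (subst (asm) mult_le_cancel_left_pos) auto
      then show ?thesis unfolding y_def by (simp add: exp_minus field_simps)
    qed
    then have "norm (A q (real n)) \<le> exp (- p) powr (1 / p)"
      using p by (intro norm_blinfun_bound le_of_powr_le) auto
    then show ?thesis using p by (simp add: exp_powr_real)
  qed
  show ?thesis
    using \<open>q \<in> S\<close>
  proof (induction n arbitrary: q rule: less_induct)
    case (less n)
    show ?case
    proof (cases "visits (\<phi> 1) S n q > N")
      case False
      \<comment> \<open>With at most \<open>N\<close> visits the exponent is still nonnegative,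
        thanks to the leading 1, and plain boundedness suffices.\<close>
      then have "1 \<le> exp (1 - visits (\<phi> 1) S n q / N)" using N0 by simp
      then have "B powr (1 / p) * 1 \<le> B powr (1 / p) * exp (1 - visits (\<phi> 1) S n q / N)"
        by (intro mult_left_mono) auto
      then show ?thesis using bounded[OF less.prems, of n] by linarith
    next
      case True
      \<comment> \<open>Exactly \<open>N\<close> visits precede \<open>m\<close>, enough to
        contract, and the orbit is in \<open>S\<close> at time \<open>m\<close>, so induction
        applies to the rest.\<close>
      then obtain m where m: "m < n" "visits (\<phi> 1) S m q = N" "(\<phi> 1 ^^ m) q \<in> S"
        using visits_reach[of N "\<phi> 1" S n q] by auto
      then have "m > 0" using N0 by (intro Nat.gr0I) auto
      obtain l where l: "n = m + l" using m(1) less_imp_add_positive by blast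
      have v: "visits (\<phi> 1) S n q = N + visits (\<phi> 1) S l ((\<phi> 1 ^^ m) q)"
        unfolding l visits_add m(2) by simp
      have "norm (A q (real n)) \<le> norm (A ((\<phi> 1 ^^ m) q) (real l)) * norm (A q (real m))"
        using norm_cocycle_add[of "real m" "real l" q] by (simp add: l flow_of_nat add.commute)
      also have "\<dots> \<le> (B powr (1 / p) * exp (1 - visits (\<phi> 1) S l ((\<phi> 1 ^^ m) q) / N)) * exp (- 1)"
        using less.IH[of l "(\<phi> 1 ^^ m) q"] contract[of q m] less.prems m l \<open>m > 0\<close>
        by (intro mult_mono) auto
      also have "\<dots> = B powr (1 / p) * exp (1 - visits (\<phi> 1) S n q / N)"
        unfolding v using N0 by (simp add: exp_add[symmetric] add_divide_distrib mult.assoc)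
      finally show ?thesis .
    qed
  qed
qed

lemma exponent_neg:
  fixes C :: "'m \<Rightarrow> real"
  assumes p: "p > 0" and C: "C \<in> borel_measurable borel" and C_pos: "\<And>q. C q > 0"
    and int: "AE q in M. \<forall>x. set_integrable lborel {0..} (\<lambda>t. norm (A q t x) powr p) \<and>
      (LBINT t:{0..}. norm (A q t x) powr p) powr (1 / p) \<le> C q * norm x"
  shows "exponent < 0"
proof -
  have [measurable]: "C \<in> borel_measurable M"
    using C by (simp cong: measurable_cong_sets add: sets_M)
  define P where "P q \<longleftrightarrow> (\<forall>x. set_integrable lborel {0..} (\<lambda>t. norm (A q t x) powr p) \<and>
      (LBINT t:{0..}. norm (A q t x) powr p) powr (1 / p) \<le> C q * norm x)" for q
  have "AE q in M. P q" using int by (simp add: P_def)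
  then obtain N0 where N0: "{q \<in> space M. \<not> P q} \<subseteq> N0" "emeasure M N0 = 0" "N0 \<in> events"
    by (rule AE_E)
  \<comment> \<open>Removing the null set makes the integral bound hold at every point of
    \<open>S n\<close>.\<close>
  define S where "S n = {q \<in> space M. C q \<le> real n} - N0" for n :: nat
  have [measurable]: "S n \<in> events" for n
    unfolding S_def by (intro sets.Diff N0) measurable
  have "incseq S" unfolding incseq_def S_def by force
  then have "(\<lambda>n. prob (S n)) \<longlonglongrightarrow> prob (\<Union>n. S n)"
    by (intro finite_Lim_measure_incseq) auto
  also have "(\<Union>n. S n) = space M - N0" unfolding S_def using real_arch_simple by auto
  also have "prob (space M - N0) = 1" using N0 prob_compl[of N0] by (simp add: measure_def)
  finally have "eventually (\<lambda>n. prob (S n) > 3 / 4) sequentially" by (rule order_tendstoD(1)) simp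
  \<comment> \<open>With \<open>3 / 4\<close>, the complement has measure below
    \<open>1 / 4\<close>, so the maximal inequality at level \<open>1 / 2\<close> gives
    \<open>prob W < 1 / 2\<close>. Then \<open>S c - W\<close> has positive measure, and its orbits
    start in \<open>S c\<close>.\<close>
  then obtain c where c: "prob (S c) > 3 / 4" using eventually_happens'[OF sequentially_bot] by blast
  define B where "B = 1 + exp (K * p) * real c powr p"
  define N where "N = nat \<lceil>B\<^sup>2 * exp p\<rceil>"
  have "B \<ge> 1" unfolding B_def by simp
  then have "0 < B\<^sup>2 * exp p" by simp
  moreover have N: "B\<^sup>2 * exp p \<le> real N" unfolding N_def by (rule real_nat_ceiling_ge)
  ultimately have "real N > 0" by linarith
  have sum: "(\<Sum>k<n. norm (A q (real k) x) powr p) \<le> B * norm x powr p" if "q \<in> S c" for q x n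
    unfolding B_def
  proof (rule sum_powr_le[OF p, where c = "C q"])
    have "P q" using that N0(1) by (auto simp: S_def)
    then show "set_integrable lborel {0..} (\<lambda>t. norm (A q t x) powr p)"
      "(LBINT t:{0..}. norm (A q t x) powr p) powr (1 / p) \<le> C q * norm x" by (auto simp: P_def)
  qed (use that C_pos[of q] in \<open>auto simp: S_def\<close>)
  \<comment> \<open>Each visit contributes \<open>- 1 / N\<close> to the exponent, and at least half
    of all times are visits.\<close>
  define r where "r = - 1 / (2 * real N)"
  define W where "W = {q \<in> space M. \<exists>n\<ge>1. visits (\<phi> 1) (- S c) n q \<ge> 1 / 2 * real n}"
  have [measurable]: "- S c \<in> events" using sets.compl_sets[of "S c" M] by (simp add: Compl_eq_Diff_UNIV)
  have [measurable]: "W \<in> events" unfolding W_def by measurable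
  have "1 / 2 * prob W \<le> prob (- S c)" unfolding W_def by (rule maximal_inequality) auto
  also have "prob (- S c) = 1 - prob (S c)"
    using prob_compl[of "S c"] by (simp add: Compl_eq_Diff_UNIV)
  finally have "prob W < 1 / 2" using c by simp
  then have "prob (S c - W) > 0"
    using c finite_measure_Diff'[of "S c" W] finite_measure_mono[of "S c \<inter> W" W] by simp
  moreover have "q \<in> growth_le r" if "q \<in> S c - W" for q
  proof (rule growth_leI)
    fix n :: nat assume "n \<ge> 1"
    have "norm (A q (real n)) \<le> B powr (1 / p) * exp (1 - visits (\<phi> 1) (S c) n q / N)"
      using that by (intro norm_le_exp_visits p \<open>B \<ge> 1\<close> N sum) auto
    also have "\<dots> \<le> B powr (1 / p) * exp (1 + r * n)"
    proof -
      have "visits (\<phi> 1) (- S c) n q < 1 / 2 * real n"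
        using that \<open>n \<ge> 1\<close> by (auto simp: W_def)
      then have "n / 2 \<le> visits (\<phi> 1) (S c) n q"
        using visits_add_Compl[of "\<phi> 1" "S c" n q] by simp
      then have "n / 2 / N \<le> visits (\<phi> 1) (S c) n q / N" by (intro divide_right_mono) auto
      then show ?thesis by (intro mult_left_mono) (auto simp: r_def)
    qed
    finally show "norm (A q (real n)) \<le> (B powr (1 / p) * exp 1) * exp (r * real n)"
      by (simp add: exp_add)
  qed
  ultimately have "prob (growth_le r) = 1" by (intro prob_growth_le_eq_1[of "S c - W"]) auto
  then have "exponent \<le> ereal r" by (rule exponent_le)
  also have "ereal r < 0" using \<open>real N > 0\<close> by (simp add: r_def)
  finally show ?thesis .
qed

end

theorem theorem4:
  fixes \<phi> :: "real \<Rightarrow> 'm::metric_space \<Rightarrow> 'm"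
    and A :: "'m \<Rightarrow> real \<Rightarrow> 'x::banach \<Rightarrow>\<^sub>L 'x"
    and \<mu> :: "'m measure"
    and p :: real
    and C :: "'m \<Rightarrow> real"
  assumes "compact (UNIV :: 'm set)"
    and "separable_space (euclidean :: 'x topology)"
    and "semi_flow \<phi>"
    and "cocycle \<phi> A"
    and "sets \<mu> = sets borel"
    and "prob_space \<mu>"
    and "ergodic_measure \<phi> \<mu>"
    and "p > 0"
    and "C \<in> borel_measurable borel"
    and "\<And>q. C q > 0"
    and "AE q in \<mu>. \<forall>x.
           set_integrable lborel {0..} (\<lambda>t. norm (blinfun_apply (A q t) x) powr p) \<and>
           (LBINT t:{0..}. norm (blinfun_apply (A q t) x) powr p) powr (1 / p) \<le> C q * norm x"
  shows "largest_lyapunov_exponent \<mu> A < 0"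
proof -
  obtain K where K: "\<forall>q. \<forall>t\<in>{0..1}. norm (A q t) \<le> K"
    using cocycle_locally_bounded[OF assms(1,4)] ..
  interpret prob_space \<mu> by fact
  \<comment> \<open>The absolute value supplies nonnegativity, and
    \<open>K \<le> exp \<bar>K\<bar>\<close> the bound.\<close>
  interpret ergodic_cocycle \<mu> \<phi> A "\<bar>K\<bar>"
  proof unfold_locales
    fix q and t :: real assume "0 \<le> t" "t \<le> 1"
    then have "norm (A q t) \<le> K" using K by simp
    then show "norm (A q t) \<le> exp \<bar>K\<bar>" using exp_ge_add_one_self[of "\<bar>K\<bar>"] by linarith
  qed (use assms in auto)
  show ?thesis
    unfolding largest_lyapunov_exponent using assms(8-11) by (rule exponent_neg)
qed

end
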